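(* Let $v,k$ be integers such that $v>2k$, $k\ge 3$, $\gcd(v,2k)=1$ and $\gcd(v,k+1)=1$. Define $$A=\binom{v-3}{2k-3}\frac{v(4k^2-10k+2)+8k}{(2k-2)(2k-1)},\qquad B=2\binom{v-3}{k-2}\frac{v-k-1}{k-1}.$$ If $A/B$ is an integer, then for any integer $z_1$ with $1\le z_1\le (v-1)/2$ such that $z_2=z_1A/B\le \frac{1}{k+1}\binom{v-1}{k}$, there exists a simple $3-(2v,2(k+1),\Theta^* )$ design with $$\Theta^*=\binom{v-2}{2k-2}\frac{4k}{2k-1}z_1+\binom{v-2}{k-1}(k+1)z_2 .$$
   Context: A $t-(v,k,\lambda)$ design is a pair $(X,\mathcal B)$ with $|X|=v$ and $\mathcal B$ a collection of $k$-subsets (blocks) of $X$ such that every $t$-subset of $X$ is contained in exactly $\lambda$ blocks. It is simple if it has no repeated blocks. *)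

theory Defs
  imports Complex_Main "HOL-Library.Multiset"
begin

(* Blocks form a multiset, so that repeated blocks are possible and simplicity is a genuine
   condition; Lam is the index lambda of a t-(v,k,lambda) design. *)
definition t_design :: "nat \<Rightarrow> nat \<Rightarrow> nat \<Rightarrow> nat \<Rightarrow> 'a set \<Rightarrow> 'a set multiset \<Rightarrow> bool" where
  "t_design t v k Lam X \<B> \<longleftrightarrow>
     finite X \<and> card X = v \<and>
     (\<forall>b. b \<in># \<B> \<longrightarrow> b \<subseteq> X \<and> card b = k) \<and>
     (\<forall>T. T \<subseteq> X \<and> card T = t \<longrightarrow> size {# b \<in># \<B>. T \<subseteq> b #} = Lam)"

definition simple_design :: "nat \<Rightarrow> nat \<Rightarrow> nat \<Rightarrow> nat \<Rightarrow> 'a set \<Rightarrow> 'a set multiset \<Rightarrow> bool" where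
  "simple_design t v k Lam X \<B> \<longleftrightarrow> t_design t v k Lam X \<B> \<and> (\<forall>b. count \<B> b \<le> 1)"

end

theory Submission
  imports Defs "HOL-Library.FuncSet" "HOL-Number_Theory.Cong"
begin

text \<open>
  The points are two copies of the cyclic group \<open>\<int>/v\<close>, and a block is a pair \<open>(S, T)\<close> with \<open>S\<close> in the
  first copy and \<open>T\<close> in the second, of sizes \<open>(2 k, 2)\<close>, \<open>(2, 2 k)\<close> or \<open>(k + 1, k + 1)\<close>.  Such a family
  is kept under control by a colouring of the \<open>j\<close>-subsets of \<open>\<int>/v\<close>, for \<open>j = 2 k, 2, k + 1\<close>, each of
  whose colour classes has the same size and covers all points equally often.  If \<open>j\<close> is coprime to
  \<open>v\<close>, then every \<open>j\<close>-subset is in exactly one way a translate of a \<open>j\<close>-subset with element sum \<open>0\<close>;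
  hence any equitable colouring of the zero-sum subsets, extended to be constant on translation
  orbits, will do (\<open>ex_balanced_colouring\<close>).

  Two subsets are joined to a block when the sum of their colours modulo the number \<open>n\<close> of colours
  is below \<open>z\<close>.  So each \<open>S\<close> meets exactly \<open>z\<close> colour classes in the other copy, and the number of
  blocks on a given triple depends only on how the triple is distributed over the copies
  (\<open>card_coupled_pairs_containing\<close>).  With \<open>n = (v - 1)/2\<close> and \<open>z = z1\<close> for the unequal sizes, and
  \<open>n = (v-1 choose k)/(k + 1)\<close> and \<open>z = z2\<close> for the equal ones, a triple inside one copy lies in
  \<open>(v-3 choose 2k-3) z1 v + (v-3 choose k-2) z2 v\<close> blocks, and a triple with two points in one copy and
  one in the other lies in \<open>\<Theta>\<^sup>*\<close> blocks.  The relation \<open>z2 = z1 A / B\<close> says exactly that these two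
  numbers agree (\<open>index_balance\<close>).

  One point needs an argument: the orbits of \<open>2 k\<close>-subsets must split evenly into \<open>(v - 1)/2\<close> classes,
  which amounts to \<open>k (2 k - 1)\<close> dividing \<open>v-2 choose 2k-2\<close>.  This fails for general \<open>v\<close> and \<open>k\<close>, but it
  follows from the integrality of \<open>A / B\<close> (\<open>equal_classes_dvd\<close>).
\<close>

section \<open>Balanced colourings of the subsets of a cyclic group\<close>

definition ksubsets :: "nat \<Rightarrow> nat \<Rightarrow> int set set" where
  "ksubsets v j = {S. S \<subseteq> {0..<int v} \<and> card S = j}"

definition translate :: "nat \<Rightarrow> int \<Rightarrow> int set \<Rightarrow> int set" where
  "translate v t S = (\<lambda>x. (x + t) mod int v) ` S"

lemma finite_ksubsets [simp]: "finite (ksubsets v j)"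
  by (rule finite_subset[of _ "Pow {0..<int v}"]) (auto simp: ksubsets_def)

lemma card_ksubsets: "card (ksubsets v j) = v choose j"
  using n_subsets[of "{0..<int v}" j] by (simp add: ksubsets_def)

lemma ksubsets_finite: "S \<in> ksubsets v j \<Longrightarrow> finite S"
  by (auto simp: ksubsets_def intro: finite_subset)

lemma inj_on_translation:
  assumes "S \<subseteq> {0..<int v}"
  shows "inj_on (\<lambda>x. (x + t) mod int v) S"
proof (rule inj_onI)
  fix x y assume xy: "x \<in> S" "y \<in> S" "(x + t) mod int v = (y + t) mod int v"
  have "(x + t - t) mod int v = (y + t - t) mod int v"
    using xy(3) by (metis mod_diff_left_eq)
  then have "x mod int v = y mod int v" by simp
  then show "x = y" using xy(1,2) assms by (auto simp: subset_iff)
qed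

lemma translate_translate: "translate v s (translate v t S) = translate v (t + s) S"
  by (simp add: translate_def image_image mod_add_left_eq add.assoc)

lemma translate_0: "S \<subseteq> {0..<int v} \<Longrightarrow> translate v 0 S = S"
  by (force simp: translate_def image_iff)

lemma translate_in_ksubsets:
  assumes "v > 0" "S \<in> ksubsets v j"
  shows "translate v t S \<in> ksubsets v j"
  using assms inj_on_translation[of S v t]
  by (auto simp: ksubsets_def translate_def card_image)

lemma sum_translate:
  assumes "S \<in> ksubsets v j"
  shows "\<Sum>(translate v t S) mod int v = (\<Sum>S + int j * t) mod int v"
proof -
  have "\<Sum>(translate v t S) = (\<Sum>x\<in>S. (x + t) mod int v)"
    unfolding translate_def
    using assms inj_on_translation[of S v t] by (simp add: ksubsets_def sum.reindex)
  then have "\<Sum>(translate v t S) mod int v = (\<Sum>x\<in>S. x + t) mod int v"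
    by (simp add: mod_sum_eq)
  then show ?thesis using assms by (simp add: sum.distrib ksubsets_def)
qed

text \<open>
  Translating a \<open>j\<close>-subset by \<open>t\<close> adds \<open>j t\<close> to the sum of its elements.  As \<open>j\<close> is invertible modulo
  \<open>v\<close>, with inverse \<open>u\<close>, the product of \<open>u\<close> and the sum is a coordinate along each translation orbit, so
  all orbits are regular and the zero-sum sets represent them.
\<close>

lemma translate_orbits_bij:
  assumes v: "v > 0" and u: "[u * int j = 1] (mod int v)"
  defines "R \<equiv> {S \<in> ksubsets v j. (u * \<Sum>S) mod int v = 0}"
  shows "bij_betw (\<lambda>(S, t). translate v t S) (R \<times> {0..<int v}) (ksubsets v j)"
proof -
  define off where "off S = (u * \<Sum>S) mod int v" for S :: "int set"
  have off: "off (translate v t S) = (off S + t) mod int v" if "S \<in> ksubsets v j" for S t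
  proof -
    have "off (translate v t S) = (u * (\<Sum>S + int j * t)) mod int v"
      unfolding off_def using sum_translate[OF that, of t] by (metis mod_mult_right_eq)
    also have "\<dots> = (u * \<Sum>S + (u * int j) * t) mod int v"
      by (simp add: algebra_simps)
    also have "\<dots> = (off S + 1 * t) mod int v"
      unfolding off_def cong_def[symmetric]
      by (rule cong_add[OF _ cong_mult[OF u cong_refl]]) (simp add: cong_def)
    finally show ?thesis by simp
  qed
  have R: "R = {S \<in> ksubsets v j. off S = 0}" by (simp add: R_def off_def)
  have normal: "translate v (- off S) S \<in> R" if "S \<in> ksubsets v j" for S
    using that off[OF that] translate_in_ksubsets[OF v that] by (simp add: R)
  have undo: "translate v t (translate v (- t) S) = S" if "S \<in> ksubsets v j" for S t
    using that by (simp add: translate_translate translate_0 ksubsets_def)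
  define f where "f = (\<lambda>(S, t). translate v t S)"
  define g where "g S = (translate v (- off S) S, off S)" for S
  have "bij_betw f (R \<times> {0..<int v}) (ksubsets v j)"
  proof (rule bij_betwI[where g = g])
    show "f \<in> R \<times> {0..<int v} \<rightarrow> ksubsets v j"
      using translate_in_ksubsets[OF v] by (auto simp: R f_def)
    show "g \<in> ksubsets v j \<rightarrow> R \<times> {0..<int v}"
      using normal v by (auto simp: g_def off_def)
    show "f (g S) = S" if "S \<in> ksubsets v j" for S
      using undo[OF that] by (simp add: f_def g_def)
    show "g (f p) = p" if "p \<in> R \<times> {0..<int v}" for p
    proof -
      obtain S t where p: "p = (S, t)" by (cases p)
      then have S: "S \<in> ksubsets v j" "off S = 0" and t: "t \<in> {0..<int v}"
        using that by (auto simp: R)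
      have "off (translate v t S) = t" using off[OF S(1), of t] S t by simp
      then show "g (f p) = p" using undo[OF S(1), of "- t"] by (simp add: p f_def g_def)
    qed
  qed
  then show ?thesis by (simp add: f_def)
qed

text \<open>
  The translate of \<open>S\<close> by \<open>t\<close> contains \<open>x\<close> if and only if \<open>x - t\<close> is one of the \<open>j\<close> elements of \<open>S\<close>.
\<close>

lemma card_translates_containing:
  assumes v: "v > 0" and S: "S \<in> ksubsets v j" and Q: "Q \<subseteq> {0..<int v}" "card Q \<le> 1"
  shows "card {t \<in> {0..<int v}. Q \<subseteq> translate v t S} = (if Q = {} then v else j)"
proof (cases "Q = {}")
  case True
  have "{t \<in> {0..<int v}. Q \<subseteq> translate v t S} = {0..<int v}" using True by auto
  then show ?thesis using True by simp
next
  case False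
  have "finite Q" using Q(1) finite_subset by blast
  then obtain x where x: "Q = {x}"
    using False Q(2) by (metis card_1_singletonE card_gt_0_iff le_antisym less_eq_Suc_le One_nat_def)
  have x': "x \<in> {0..<int v}" using x Q(1) by simp
  have S': "S \<subseteq> {0..<int v}" "card S = j" using S by (auto simp: ksubsets_def)
  have refl2: "(x - (x - y) mod int v) mod int v = y" if "y \<in> {0..<int v}" for y
    using that by (simp add: mod_diff_right_eq)
  have "bij_betw (\<lambda>y. (x - y) mod int v) S {t \<in> {0..<int v}. Q \<subseteq> translate v t S}"
  proof (rule bij_betw_byWitness[where f' = "\<lambda>t. (x - t) mod int v"])
    show "\<forall>y\<in>S. (x - (x - y) mod int v) mod int v = y" using refl2 S' by blast
    show "\<forall>t\<in>{t \<in> {0..<int v}. Q \<subseteq> translate v t S}. (x - (x - t) mod int v) mod int v = t"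
      using refl2 by blast
    show "(\<lambda>y. (x - y) mod int v) ` S \<subseteq> {t \<in> {0..<int v}. Q \<subseteq> translate v t S}"
    proof clarify
      fix y assume y: "y \<in> S"
      have "(y + (x - y) mod int v) mod int v = x"
        using x' by (simp add: mod_add_right_eq)
      then show "(x - y) mod int v \<in> {0..<int v} \<and> Q \<subseteq> translate v ((x - y) mod int v) S"
        using y v x by (force simp: translate_def image_iff)
    qed
    show "(\<lambda>t. (x - t) mod int v) ` {t \<in> {0..<int v}. Q \<subseteq> translate v t S} \<subseteq> S"
    proof clarify
      fix t assume "Q \<subseteq> translate v t S"
      then obtain y where y: "y \<in> S" "x = (y + t) mod int v"
        using x by (auto simp: translate_def)
      have "(x - t) mod int v = y mod int v" using y(2) by (simp add: mod_diff_left_eq)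
      then show "(x - t) mod int v \<in> S" using y(1) S' by (auto simp: subset_iff)
    qed
  qed
  then have "card S = card {t \<in> {0..<int v}. Q \<subseteq> translate v t S}"
    by (rule bij_betw_same_card)
  then show ?thesis using S'(2) False by simp
qed

text \<open>
  The two properties of a colour class, its size \<open>m v\<close> and its degree \<open>m j\<close> at each point, are the cases
  \<open>Q = {}\<close> and \<open>Q = {x}\<close> of one count.  The parameter \<open>m\<close> is the number of translation orbits per colour.
\<close>

definition balanced_colouring :: "nat \<Rightarrow> nat \<Rightarrow> nat \<Rightarrow> nat \<Rightarrow> (int set \<Rightarrow> nat) \<Rightarrow> bool" where
  "balanced_colouring v j n m c \<longleftrightarrow>
     (\<forall>S\<in>ksubsets v j. c S < n) \<and>
     (\<forall>i<n. \<forall>Q. Q \<subseteq> {0..<int v} \<and> card Q \<le> 1 \<longrightarrow>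
        card {S \<in> ksubsets v j. Q \<subseteq> S \<and> c S = i} = m * (if Q = {} then v else j))"

lemma ex_equal_fibres:
  assumes "finite R" "card R = n * m"
  shows "\<exists>c. (\<forall>r\<in>R. c r < n) \<and> (\<forall>i<n. card {r \<in> R. c r = i} = m)"
proof -
  obtain g where g: "bij_betw g R ({..<n} \<times> {..<m})"
    using finite_same_card_bij[of R "{..<n} \<times> {..<m}"] assms by auto
  have "card {r \<in> R. fst (g r) = i} = m" if "i < n" for i
  proof -
    have "bij_betw g {r \<in> R. fst (g r) = i} ({i} \<times> {..<m})"
    proof (rule bij_betw_subset[OF g])
      show "g ` {r \<in> R. fst (g r) = i} = {i} \<times> {..<m}"
      proof
        show "g ` {r \<in> R. fst (g r) = i} \<subseteq> {i} \<times> {..<m}"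
          using bij_betwE[OF g] by (fastforce simp: mem_Times_iff)
        show "{i} \<times> {..<m} \<subseteq> g ` {r \<in> R. fst (g r) = i}"
        proof
          fix p assume p: "p \<in> {i} \<times> {..<m}"
          then have "p \<in> g ` R" using g that by (auto simp: bij_betw_def)
          then obtain r where "r \<in> R" "p = g r" by blast
          then show "p \<in> g ` {r \<in> R. fst (g r) = i}" using p by force
        qed
      qed
    qed auto
    then show ?thesis by (simp add: bij_betw_same_card)
  qed
  moreover have "fst (g r) < n" if "r \<in> R" for r
    using bij_betwE[OF g] that by (auto simp: mem_Times_iff)
  ultimately show ?thesis by (intro exI[of _ "fst \<circ> g"]) auto
qed

text \<open>
  An orbit of \<open>v\<close> translates of a \<open>j\<close>-subset covers each point \<open>j\<close> times, so a union of \<open>m\<close> orbits is a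
  1-design.  The \<open>n m\<close> orbits are distributed evenly over the \<open>n\<close> colours.
\<close>

lemma ex_balanced_colouring:
  assumes v: "v > 0" and cop: "coprime v j" and N: "v choose j = v * (n * m)"
  shows "\<exists>c. balanced_colouring v j n m c"
proof -
  obtain u where "[int j * u = 1] (mod int v)"
    using cop cong_solve_coprime_int[of "int j" "int v"] by (auto simp: coprime_commute)
  then have u: "[u * int j = 1] (mod int v)" by (simp add: mult.commute)
  define R where "R = {S \<in> ksubsets v j. (u * \<Sum>S) mod int v = 0}"
  define f where "f = (\<lambda>(S, t). translate v t S)"
  have bij: "bij_betw f (R \<times> {0..<int v}) (ksubsets v j)"
    using translate_orbits_bij[OF v u] by (simp add: R_def f_def)
  have finR: "finite R" by (simp add: R_def)
  have "card R * v = v choose j"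
    using bij_betw_same_card[OF bij] by (simp add: card_ksubsets card_cartesian_product)
  then have "card R = n * m" using N v by simp
  then obtain c0 where c0: "\<forall>r\<in>R. c0 r < n" "\<forall>i<n. card {r \<in> R. c0 r = i} = m"
    using ex_equal_fibres[OF finR] by blast
  define g where "g = the_inv_into (R \<times> {0..<int v}) f"
  have gf: "g (f p) = p" if "p \<in> R \<times> {0..<int v}" for p
    using that bij by (simp add: g_def the_inv_into_f_f bij_betw_def)
  define c where "c S = c0 (fst (g S))" for S
  have "c S < n" if "S \<in> ksubsets v j" for S
  proof -
    have "S \<in> f ` (R \<times> {0..<int v})" using that bij by (simp add: bij_betw_def)
    then obtain p where "p \<in> R \<times> {0..<int v}" "S = f p" by blast
    then show ?thesis using gf c0(1) by (auto simp: c_def mem_Times_iff)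
  qed
  moreover have "card {S \<in> ksubsets v j. Q \<subseteq> S \<and> c S = i} = m * (if Q = {} then v else j)"
    if i: "i < n" and Q: "Q \<subseteq> {0..<int v}" "card Q \<le> 1" for i Q
  proof -
    let ?P = "SIGMA S : {r \<in> R. c0 r = i}. {t \<in> {0..<int v}. Q \<subseteq> translate v t S}"
    have sub: "?P \<subseteq> R \<times> {0..<int v}" by auto
    have "f ` ?P = {S \<in> ksubsets v j. Q \<subseteq> S \<and> c S = i}"
    proof
      show "f ` ?P \<subseteq> {S \<in> ksubsets v j. Q \<subseteq> S \<and> c S = i}"
      proof (rule image_subsetI)
        fix p assume p: "p \<in> ?P"
        then have "p \<in> R \<times> {0..<int v}" by auto
        then have "f p \<in> ksubsets v j" "g (f p) = p" using bij gf by (auto dest: bij_betwE)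
        then show "f p \<in> {S \<in> ksubsets v j. Q \<subseteq> S \<and> c S = i}"
          using p by (auto simp: c_def f_def)
      qed
      show "{S \<in> ksubsets v j. Q \<subseteq> S \<and> c S = i} \<subseteq> f ` ?P"
      proof clarify
        fix S assume S: "S \<in> ksubsets v j" "Q \<subseteq> S" "i = c S"
        have "S \<in> f ` (R \<times> {0..<int v})" using S bij by (simp add: bij_betw_def)
        then obtain p where p: "p \<in> R \<times> {0..<int v}" "S = f p" by blast
        then have "p \<in> (SIGMA S' : {r \<in> R. c0 r = c S}. {t \<in> {0..<int v}. Q \<subseteq> translate v t S'})"
          using S gf[OF p(1)] by (auto simp: c_def f_def)
        then show "S \<in> f ` (SIGMA S' : {r \<in> R. c0 r = c S}. {t \<in> {0..<int v}. Q \<subseteq> translate v t S'})"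
          using p(2) by blast
      qed
    qed
    then have "bij_betw f ?P {S \<in> ksubsets v j. Q \<subseteq> S \<and> c S = i}"
      using bij_betw_subset[OF bij sub] by simp
    then have "card {S \<in> ksubsets v j. Q \<subseteq> S \<and> c S = i} = card ?P"
      by (simp add: bij_betw_same_card)
    also have "\<dots> = (\<Sum>S\<in>{r \<in> R. c0 r = i}. card {t \<in> {0..<int v}. Q \<subseteq> translate v t S})"
    proof (rule card_SigmaI)
      show "finite {r \<in> R. c0 r = i}" using finR by simp
      show "\<forall>S\<in>{r \<in> R. c0 r = i}. finite {t \<in> {0..<int v}. Q \<subseteq> translate v t S}"
        by (rule ballI, rule finite_subset[of _ "{0..<int v}"]) auto
    qed
    also have "\<dots> = (\<Sum>S\<in>{r \<in> R. c0 r = i}. if Q = {} then v else j)"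
      using card_translates_containing[OF v _ Q] by (intro sum.cong) (auto simp: R_def)
    also have "\<dots> = m * (if Q = {} then v else j)" using c0(2) i by simp
    finally show ?thesis .
  qed
  ultimately have "balanced_colouring v j n m c" by (simp add: balanced_colouring_def)
  then show ?thesis by (rule exI[of _ c])
qed

section \<open>Coupling two colourings\<close>

definition coupled_pairs ::
    "nat \<Rightarrow> nat \<Rightarrow> (int set \<Rightarrow> nat) \<Rightarrow> nat \<Rightarrow> (int set \<Rightarrow> nat) \<Rightarrow> nat \<Rightarrow> nat \<Rightarrow> (int set \<times> int set) set" where
  "coupled_pairs v j c j' c' n z =
     {(S, T). S \<in> ksubsets v j \<and> T \<in> ksubsets v j' \<and> (c S + c' T) mod n < z}"

lemma finite_coupled_pairs: "finite (coupled_pairs v j c j' c' n z)"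
  by (rule finite_subset[of _ "ksubsets v j \<times> ksubsets v j'"]) (auto simp: coupled_pairs_def)

lemma swap_coupled_pairs:
  "prod.swap ` coupled_pairs v j c j' c' n z = coupled_pairs v j' c' j c n z"
proof -
  have iff: "(S, T) \<in> coupled_pairs v j c j' c' n z \<longleftrightarrow> (T, S) \<in> coupled_pairs v j' c' j c n z" for S T
    unfolding coupled_pairs_def by (simp add: add.commute[of "c S"] conj_commute conj_left_commute)
  have "p \<in> prod.swap ` coupled_pairs v j c j' c' n z \<longleftrightarrow> p \<in> coupled_pairs v j' c' j c n z" for p
    by (cases p) (simp only: pair_in_swap_image iff)
  then show ?thesis by blast
qed

text \<open>
  Adding \<open>a\<close> permutes the residues modulo \<open>n\<close>; hence a fixed colour is coupled with exactly \<open>z\<close> colours,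
  whichever it is.
\<close>

lemma card_cyclic_window:
  assumes "z \<le> n"
  shows "card {i. i < n \<and> (a + i) mod n < z} = z"
proof (cases "n = 0")
  case True
  then show ?thesis using assms by simp
next
  case False
  then have n: "n > 0" by simp
  have inj: "inj_on (\<lambda>i. (a + i) mod n) {..<n}"
  proof (rule inj_onI)
    fix x y assume "x \<in> {..<n}" "y \<in> {..<n}" "(a + x) mod n = (a + y) mod n"
    then show "x = y" by (metis cong_add_lcancel_nat cong_def lessThan_iff mod_less)
  qed
  have surj: "(\<lambda>i. (a + i) mod n) ` {..<n} = {..<n}"
    by (rule endo_inj_surj[OF _ _ inj]) (use n in auto)
  have "(\<lambda>i. (a + i) mod n) ` {i. i < n \<and> (a + i) mod n < z} = {..<z}"
  proof
    show "{..<z} \<subseteq> (\<lambda>i. (a + i) mod n) ` {i. i < n \<and> (a + i) mod n < z}"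
    proof
      fix y assume y: "y \<in> {..<z}"
      then have "y \<in> (\<lambda>i. (a + i) mod n) ` {..<n}" using surj assms by auto
      then obtain i where "i < n" "y = (a + i) mod n" by auto
      then show "y \<in> (\<lambda>i. (a + i) mod n) ` {i. i < n \<and> (a + i) mod n < z}" using y by auto
    qed
  qed auto
  moreover have "inj_on (\<lambda>i. (a + i) mod n) {i. i < n \<and> (a + i) mod n < z}"
    by (rule inj_on_subset[OF inj]) auto
  ultimately show ?thesis using card_image[of "\<lambda>i. (a + i) mod n" "{i. i < n \<and> (a + i) mod n < z}"]
    by simp
qed

text \<open>
  For fixed \<open>S\<close>, the partners \<open>T \<supseteq> Q\<close> fill \<open>z\<close> colour classes, each of which contributes the same
  number because \<open>Q\<close> has at most one element and \<open>c'\<close> is balanced.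
\<close>

lemma card_coupled_pairs_containing:
  assumes c': "balanced_colouring v j' n m c'" and z: "z \<le> n"
    and Q: "Q \<subseteq> {0..<int v}" "card Q \<le> 1"
  shows "card {(S, T) \<in> coupled_pairs v j c j' c' n z. P \<subseteq> S \<and> Q \<subseteq> T} =
     card {S \<in> ksubsets v j. P \<subseteq> S} * (z * m * (if Q = {} then v else j'))"
proof -
  let ?F = "\<lambda>a. {T \<in> ksubsets v j'. Q \<subseteq> T \<and> (a + c' T) mod n < z}"
  have inner: "card (?F a) = z * m * (if Q = {} then v else j')" for a
  proof -
    let ?I = "{i. i < n \<and> (a + i) mod n < z}"
    have "?F a = (\<Union>i\<in>?I. {T \<in> ksubsets v j'. Q \<subseteq> T \<and> c' T = i})"
    proof -
      have "c' T < n" if "T \<in> ksubsets v j'" for T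
        using c' that by (simp add: balanced_colouring_def)
      then show ?thesis by blast
    qed
    then have "card (?F a) = (\<Sum>i\<in>?I. card {T \<in> ksubsets v j'. Q \<subseteq> T \<and> c' T = i})"
      by (simp only:) (rule card_UN_disjoint, auto)
    also have "\<dots> = (\<Sum>i\<in>?I. m * (if Q = {} then v else j'))"
    proof (rule sum.cong[OF refl])
      fix i assume "i \<in> ?I"
      then have "i < n" by simp
      then show "card {T \<in> ksubsets v j'. Q \<subseteq> T \<and> c' T = i} = m * (if Q = {} then v else j')"
        using c' Q unfolding balanced_colouring_def by blast
    qed
    also have "\<dots> = z * m * (if Q = {} then v else j')"
      using card_cyclic_window[OF z, of a] by simp
    finally show ?thesis .
  qed
  have "{(S, T) \<in> coupled_pairs v j c j' c' n z. P \<subseteq> S \<and> Q \<subseteq> T} =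
      (SIGMA S : {S \<in> ksubsets v j. P \<subseteq> S}. ?F (c S))"
    by (auto simp: coupled_pairs_def)
  then have "card {(S, T) \<in> coupled_pairs v j c j' c' n z. P \<subseteq> S \<and> Q \<subseteq> T} =
      (\<Sum>S\<in>{S \<in> ksubsets v j. P \<subseteq> S}. card (?F (c S)))"
    by (simp only:) (rule card_SigmaI, auto)
  then show ?thesis by (simp only: inner) simp
qed

lemma card_ksubsets_containing:
  assumes P: "P \<subseteq> {0..<int v}" "card P = p"
  shows "card {S \<in> ksubsets v j. P \<subseteq> S} = (if p \<le> j then (v - p) choose (j - p) else 0)"
proof (cases "p \<le> j")
  case False
  have "\<not> P \<subseteq> S" if "S \<in> ksubsets v j" for S
    using that False P card_mono[of S P] ksubsets_finite[OF that] by (auto simp: ksubsets_def)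
  then show ?thesis using False by auto
next
  case True
  have finP: "finite P" using P(1) finite_subset by blast
  have "bij_betw (\<lambda>U. U \<union> P) {U. U \<subseteq> {0..<int v} - P \<and> card U = j - p} {S \<in> ksubsets v j. P \<subseteq> S}"
  proof (rule bij_betw_byWitness[where f' = "\<lambda>S. S - P"])
    show "(\<lambda>U. U \<union> P) ` {U. U \<subseteq> {0..<int v} - P \<and> card U = j - p} \<subseteq> {S \<in> ksubsets v j. P \<subseteq> S}"
    proof clarify
      fix U assume U: "U \<subseteq> {0..<int v} - P" "card U = j - p"
      have "finite U" using U(1) finite_subset by blast
      then have "card (U \<union> P) = j" using U finP P(2) True by (subst card_Un_disjoint) auto
      then show "U \<union> P \<in> ksubsets v j \<and> P \<subseteq> U \<union> P" using U P by (auto simp: ksubsets_def)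
    qed
    show "(\<lambda>S. S - P) ` {S \<in> ksubsets v j. P \<subseteq> S} \<subseteq> {U. U \<subseteq> {0..<int v} - P \<and> card U = j - p}"
      using finP P by (auto simp: ksubsets_def card_Diff_subset)
  qed auto
  then have "card {S \<in> ksubsets v j. P \<subseteq> S} = card {U. U \<subseteq> {0..<int v} - P \<and> card U = j - p}"
    by (simp add: bij_betw_same_card)
  also have "\<dots> = (v - p) choose (j - p)"
    using n_subsets[of "{0..<int v} - P" "j - p"] finP P by (simp add: card_Diff_subset)
  finally show ?thesis using True by simp
qed

section \<open>Designs on two copies of the cyclic group\<close>

text \<open>
  The first copy occupies the numbers below \<open>v\<close>, and the second those from \<open>v\<close> to \<open>2 v - 1\<close>.
\<close>

definition join_copies :: "nat \<Rightarrow> int set \<times> int set \<Rightarrow> nat set" where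
  "join_copies v = (\<lambda>(S, T). nat ` S \<union> (\<lambda>y. v + nat y) ` T)"

lemma join_copies_subset_iff:
  assumes "P \<subseteq> {0..<int v}" "Q \<subseteq> {0..<int v}" "S \<subseteq> {0..<int v}" "T \<subseteq> {0..<int v}"
  shows "join_copies v (P, Q) \<subseteq> join_copies v (S, T) \<longleftrightarrow> P \<subseteq> S \<and> Q \<subseteq> T"
proof
  assume sub: "join_copies v (P, Q) \<subseteq> join_copies v (S, T)"
  have "x \<in> S" if x: "x \<in> P" for x
  proof -
    have "nat x \<in> join_copies v (S, T)" using sub x by (auto simp: join_copies_def)
    moreover have x': "0 \<le> x" "x < int v" using x assms by auto
    then have "nat x < v" by linarith
    ultimately obtain y where y: "y \<in> S" "nat x = nat y" by (auto simp: join_copies_def)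
    then have "0 \<le> y" using assms by auto
    then have "x = y" using x' y by linarith
    then show "x \<in> S" using y by simp
  qed
  moreover have "x \<in> T" if x: "x \<in> Q" for x
  proof -
    have "v + nat x \<in> join_copies v (S, T)" using sub x by (auto simp: join_copies_def)
    moreover have "v + nat x \<notin> nat ` S"
    proof
      assume "v + nat x \<in> nat ` S"
      then obtain y where y: "y \<in> S" "v + nat x = nat y" by auto
      then have "0 \<le> y" "y < int v" using assms by auto
      then show False using y(2) by linarith
    qed
    ultimately obtain y where y: "y \<in> T" "nat x = nat y" by (auto simp: join_copies_def)
    then have "0 \<le> y" "0 \<le> x" using assms x by auto
    then have "x = y" using y by linarith
    then show "x \<in> T" using y by simp
  qed
  ultimately show "P \<subseteq> S \<and> Q \<subseteq> T" by blast
qed (auto simp: join_copies_def)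

lemma join_copies_subset:
  assumes "S \<subseteq> {0..<int v}" "T \<subseteq> {0..<int v}"
  shows "join_copies v (S, T) \<subseteq> {0..<2 * v}"
proof -
  have "nat x < v" if "x \<in> S \<union> T" for x using that assms by fastforce
  then show ?thesis by (fastforce simp: join_copies_def)
qed

lemma card_join_copies:
  assumes "S \<subseteq> {0..<int v}" "T \<subseteq> {0..<int v}"
  shows "card (join_copies v (S, T)) = card S + card T"
proof -
  have fin: "finite S" "finite T" using assms finite_subset by blast+
  have lt: "nat x < v" if "x \<in> S" for x using that assms by fastforce
  have "nat ` S \<inter> (\<lambda>y. v + nat y) ` T = {}" using lt by fastforce
  moreover have "inj_on nat S" "inj_on (\<lambda>y. v + nat y) T"
    using assms by (force simp: inj_on_def subset_iff nat_eq_iff)+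
  ultimately show ?thesis
    using fin by (simp add: join_copies_def card_Un_disjoint card_image)
qed

lemma join_copies_surj:
  assumes "X \<subseteq> {0..<2 * v}"
  obtains P Q where "P \<subseteq> {0..<int v}" "Q \<subseteq> {0..<int v}" "X = join_copies v (P, Q)"
proof
  let ?P = "int ` {x \<in> X. x < v}" and ?Q = "(\<lambda>x. int (x - v)) ` {x \<in> X. v \<le> x}"
  show "?P \<subseteq> {0..<int v}" "?Q \<subseteq> {0..<int v}" using assms by force+
  show "X = join_copies v (?P, ?Q)"
  proof -
    have "nat ` ?P = {x \<in> X. x < v}" by (simp add: image_image)
    moreover have "(\<lambda>y. v + nat y) ` ?Q = {x \<in> X. v \<le> x}"
      by (force simp: image_image image_iff nat_diff_distrib)
    ultimately show ?thesis by (auto simp: join_copies_def)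
  qed
qed

text \<open>
  A triple has at least two points in one of the copies, and by the symmetry of the family this may be
  taken to be the first.  Only two distributions are left to count.
\<close>

lemma simple_design_of_symmetric_pairs:
  assumes C: "\<And>S T. (S, T) \<in> C \<Longrightarrow> S \<subseteq> {0..<int v} \<and> T \<subseteq> {0..<int v} \<and> card S + card T = b"
    and sym: "prod.swap ` C = C"
    and three: "\<And>P. P \<subseteq> {0..<int v} \<Longrightarrow> card P = 3 \<Longrightarrow> card {(S, T) \<in> C. P \<subseteq> S} = L"
    and two: "\<And>P x. P \<subseteq> {0..<int v} \<Longrightarrow> card P = 2 \<Longrightarrow> x \<in> {0..<int v} \<Longrightarrow>
                card {(S, T) \<in> C. P \<subseteq> S \<and> {x} \<subseteq> T} = L"
  shows "simple_design 3 (2 * v) b L {0..<2 * v} (mset_set (join_copies v ` C))"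
proof -
  have "C \<subseteq> Pow {0..<int v} \<times> Pow {0..<int v}" using C by fast
  then have finC: "finite C" by (rule finite_subset) auto
  have inj: "inj_on (join_copies v) C"
  proof (rule inj_onI, clarify)
    fix S T S' T' assume ST: "(S, T) \<in> C" "(S', T') \<in> C" "join_copies v (S, T) = join_copies v (S', T')"
    have "join_copies v (S, T) \<subseteq> join_copies v (S', T')" "join_copies v (S', T') \<subseteq> join_copies v (S, T)"
      using ST(3) by auto
    then show "S = S' \<and> T = T'"
      using C[OF ST(1)] C[OF ST(2)] by (auto simp: join_copies_subset_iff)
  qed
  have swapcount: "card {(S, T) \<in> C. P \<subseteq> S \<and> Q \<subseteq> T} = card {(S, T) \<in> C. Q \<subseteq> S \<and> P \<subseteq> T}" for P Q
  proof -
    have "{(S, T) \<in> C. Q \<subseteq> S \<and> P \<subseteq> T} = prod.swap ` {(S, T) \<in> C. P \<subseteq> S \<and> Q \<subseteq> T}"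
    proof -
      have "(T, S) \<in> C" if "(S, T) \<in> C" for S T
        using that sym by (metis image_eqI swap_simp)
      then show ?thesis by (auto simp: image_iff) 
    qed
    then show ?thesis by (simp add: card_image)
  qed
  have count: "card {(S, T) \<in> C. P \<subseteq> S \<and> Q \<subseteq> T} = L"
    if PQ: "P \<subseteq> {0..<int v}" "Q \<subseteq> {0..<int v}" "card P + card Q = 3" for P Q
  proof -
    have fin: "finite P" "finite Q" using PQ finite_subset by blast+
    have main: "card {(S, T) \<in> C. P' \<subseteq> S \<and> Q' \<subseteq> T} = L"
      if "P' \<subseteq> {0..<int v}" "Q' \<subseteq> {0..<int v}" "finite Q'" "card P' + card Q' = 3" "card Q' \<le> 1" for P' Q'
    proof (cases "card Q' = 0")
      case True
      then show ?thesis using three[of P'] that by simp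
    next
      case False
      then have "card Q' = 1" using that by linarith
      then obtain x where "Q' = {x}" by (rule card_1_singletonE)
      then show ?thesis using two[of P' x] that by simp
    qed
    show ?thesis
    proof (cases "card Q \<le> 1")
      case True
      then show ?thesis using main[of P Q] PQ fin by simp
    next
      case False
      then show ?thesis using main[of Q P] PQ fin swapcount[of P Q] by simp
    qed
  qed
  have index: "size {# b \<in># mset_set (join_copies v ` C). X \<subseteq> b #} = L"
    if X: "X \<subseteq> {0..<2 * v}" "card X = 3" for X
  proof -
    obtain P Q where PQ: "P \<subseteq> {0..<int v}" "Q \<subseteq> {0..<int v}" "X = join_copies v (P, Q)"
      using join_copies_surj[OF X(1)] by blast
    have "card P + card Q = 3" using X(2) PQ card_join_copies by simp
    then have L: "card {(S, T) \<in> C. P \<subseteq> S \<and> Q \<subseteq> T} = L" using count PQ by simp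
    have "size {# b \<in># mset_set (join_copies v ` C). X \<subseteq> b #} = card {b \<in> join_copies v ` C. X \<subseteq> b}"
      using finC by (simp add: filter_mset_mset_set)
    also have "{b \<in> join_copies v ` C. X \<subseteq> b} = join_copies v ` {(S, T) \<in> C. P \<subseteq> S \<and> Q \<subseteq> T}"
    proof -
      have "X \<subseteq> join_copies v (S, T) \<longleftrightarrow> P \<subseteq> S \<and> Q \<subseteq> T" if "(S, T) \<in> C" for S T
        using C[OF that] PQ join_copies_subset_iff[of P v Q S T] by simp
      then show ?thesis by fast
    qed
    also have "card \<dots> = card {(S, T) \<in> C. P \<subseteq> S \<and> Q \<subseteq> T}"
      by (intro card_image inj_on_subset[OF inj]) auto
    finally show ?thesis using L by simp
  qed
  have block: "b' \<subseteq> {0..<2 * v} \<and> card b' = b" if "b' \<in># mset_set (join_copies v ` C)" for b'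
  proof -
    obtain S T where ST: "(S, T) \<in> C" "b' = join_copies v (S, T)" using \<open>b' \<in># _\<close> finC by auto
    then show ?thesis
      using C[OF ST(1)] join_copies_subset[of S v T] card_join_copies[of S v T] by simp
  qed
  have "count (mset_set (join_copies v ` C)) b' \<le> 1" for b'
    by (cases "b' \<in> join_copies v ` C") (simp_all add: count_mset_set finC)
  moreover have "t_design 3 (2 * v) b L {0..<2 * v} (mset_set (join_copies v ` C))"
    unfolding t_design_def
  proof (intro conjI allI impI)
    show "card {0..<2 * v} = 2 * v" by simp
    show "b' \<subseteq> {0..<2 * v}" "card b' = b" if "b' \<in># mset_set (join_copies v ` C)" for b'
      by (rule conjunct1[OF block[OF that]], rule conjunct2[OF block[OF that]])
    show "size {# b \<in># mset_set (join_copies v ` C). X \<subseteq> b #} = L"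
      if "X \<subseteq> {0..<2 * v} \<and> card X = 3" for X
      by (rule index[OF conjunct1[OF that] conjunct2[OF that]])
  qed (rule finite_atLeastLessThan)
  ultimately show ?thesis by (simp only: simple_design_def simp_thms)
qed

section \<open>Arithmetic of the parameters\<close>

lemma int_times_binomial:
  assumes "0 < k" "0 < n"
  shows "int k * int (n choose k) = int n * int ((n - 1) choose (k - 1))"
  using times_binomial_minus1_eq[OF assms(1), of n] by (metis of_nat_mult)

text \<open>
  The factors \<open>2 k - 2\<close> and \<open>2 k - 1\<close> of the denominators are cleared and a common factor \<open>2\<close> is
  cancelled, so that \<open>A = q B\<close> can be used for divisibility arguments.
\<close>

lemma balance_equation_integral:
  fixes v k :: nat and q :: int and A B :: real
  assumes k: "v > 2 * k" "k \<ge> 3"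
    and A: "A = real ((v - 3) choose (2 * k - 3))
              * ((real v * (4 * real k ^ 2 - 10 * real k + 2) + 8 * real k)
                 / ((2 * real k - 2) * (2 * real k - 1)))"
    and B: "B = 2 * real ((v - 3) choose (k - 2)) * ((real v - real k - 1) / (real k - 1))"
    and q: "A / B = of_int q"
  shows "int ((v - 3) choose (2 * k - 3)) * (int v * (2 * int k ^ 2 - 5 * int k + 1) + 4 * int k)
       = 2 * int ((v - 3) choose (k - 2)) * (int v - int k - 1) * (2 * int k - 1) * q"
proof -
  define V K where "V = real v" and "K = real k"
  define Y D where "Y = real ((v - 3) choose (2 * k - 3))" and "D = real ((v - 3) choose (k - 2))"
  have pos: "K - 1 > 0" "2 * K - 1 > 0" "V - K - 1 > 0" "D > 0"
    using k by (auto simp: V_def K_def D_def)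
  have "B > 0" using pos by (simp add: B flip: V_def K_def D_def)
  then have "A = B * of_int q" using q by (simp add: field_simps)
  then have "Y * ((V * (4 * K ^ 2 - 10 * K + 2) + 8 * K) / ((2 * K - 2) * (2 * K - 1)))
      = 2 * D * ((V - K - 1) / (K - 1)) * of_int q"
    by (simp add: A B V_def K_def Y_def D_def)
  moreover have "(V * (4 * K ^ 2 - 10 * K + 2) + 8 * K) / ((2 * K - 2) * (2 * K - 1))
      = (V * (2 * K ^ 2 - 5 * K + 1) + 4 * K) / ((K - 1) * (2 * K - 1))"
    using pos by (simp add: divide_simps algebra_simps)
  ultimately have "Y * (V * (2 * K ^ 2 - 5 * K + 1) + 4 * K) / ((K - 1) * (2 * K - 1))
      = 2 * D * (V - K - 1) * of_int q / (K - 1)"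
    by simp
  then have "Y * (V * (2 * K ^ 2 - 5 * K + 1) + 4 * K) = 2 * D * (V - K - 1) * (2 * K - 1) * of_int q"
    using pos by (simp add: divide_simps)
  then have "real_of_int (int ((v - 3) choose (2 * k - 3)) * (int v * (2 * int k ^ 2 - 5 * int k + 1) + 4 * int k))
       = real_of_int (2 * int ((v - 3) choose (k - 2)) * (int v - int k - 1) * (2 * int k - 1) * q)"
    by (simp add: V_def K_def Y_def D_def)
  then show ?thesis by (simp only: of_int_eq_iff)
qed

text \<open>
  Write \<open>X\<close> for the binomial coefficient \<open>v-2 choose 2k-2\<close>, \<open>W\<close> for \<open>v-2 choose k-1\<close>, and \<open>E\<close> for the
  bracket \<open>v (2 k\<^sup>2 - 5 k + 1) + 4 k\<close>.  The balance equation becomes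
  \<open>(k - 1) E X = (2 k - 1) q (v - 1 - k) (k - 1) W\<close>.  The absorption identity gives \<open>k\<close> dividing
  \<open>(v - 1) W\<close>, so \<open>k\<close> divides the right-hand side, and \<open>E \<equiv> v\<close> modulo \<open>k\<close> is a unit; hence \<open>k\<close>
  divides \<open>X\<close>.  The right-hand side is also a multiple of \<open>2 k - 1\<close>, modulo which \<open>E \<equiv> 2 - v\<close>, so
  \<open>2 k - 1\<close> divides \<open>(v - 2) X\<close>; it divides \<open>(v - 1) X\<close> by absorption, hence the difference \<open>X\<close>.
\<close>

lemma equal_classes_dvd:
  fixes v k :: nat and q :: int
  assumes k: "v > 2 * k" "k \<ge> 3" and cop: "coprime v k"
    and bal: "int ((v - 3) choose (2 * k - 3)) * (int v * (2 * int k ^ 2 - 5 * int k + 1) + 4 * int k)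
       = 2 * int ((v - 3) choose (k - 2)) * (int v - int k - 1) * (2 * int k - 1) * q"
  shows "k * (2 * k - 1) dvd (v - 2) choose (2 * k - 2)"
proof -
  define V K where "V = int v" and "K = int k"
  define Y D where "Y = int ((v - 3) choose (2 * k - 3))" and "D = int ((v - 3) choose (k - 2))"
  define X W where "X = int ((v - 2) choose (2 * k - 2))" and "W = int ((v - 2) choose (k - 1))"
  define E where "E = V * (2 * K ^ 2 - 5 * K + 1) + 4 * K"
  have casts: "int (2 * k - 2) = 2 * K - 2" "int (2 * k - 1) = 2 * K - 1" "int (k - 1) = K - 1"
    "int (v - 2) = V - 2" "int (v - 1) = V - 1"
    using k by (auto simp: V_def K_def of_nat_diff)
  have XY: "(2 * K - 2) * X = (V - 2) * Y"
    using int_times_binomial[of "2 * k - 2" "v - 2"] k casts by (simp add: X_def Y_def)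
  have WD: "(K - 1) * W = (V - 2) * D"
    using int_times_binomial[of "k - 1" "v - 2"] k casts by (simp add: W_def D_def numeral_2_eq_2 numeral_3_eq_3)
  have W: "K * int ((v - 1) choose k) = (V - 1) * W"
    using int_times_binomial[of k "v - 1"] k casts by (simp add: W_def K_def numeral_2_eq_2)
  have X: "(2 * K - 1) * int ((v - 1) choose (2 * k - 1)) = (V - 1) * X"
    using int_times_binomial[of "2 * k - 1" "v - 1"] k casts by (simp add: X_def numeral_2_eq_2)
  have "Y * E = 2 * D * (V - K - 1) * (2 * K - 1) * q"
    using bal by (simp add: E_def V_def K_def Y_def D_def)
  then have "2 * ((K - 1) * E * X) = 2 * ((2 * K - 1) * q * (V - 1 - K) * ((V - 2) * D))"
    using XY by algebra
  then have key: "(K - 1) * E * X = (2 * K - 1) * q * (V - 1 - K) * ((K - 1) * W)"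
    using WD by simp
  have coprime_if: "coprime a b" if "x * a + y * b = 1" for a b x y :: int
    using that by (metis coprimeI dvd_add dvd_mult)
  have "K dvd X"
  proof -
    have "(K - 1) * E * X = K * ((2 * K - 1) * q * (K - 1) * (int ((v - 1) choose k) - W))"
      using key W by algebra
    then have "K dvd (K - 1) * E * X" by (rule dvdI)
    moreover have "coprime K (K - 1)" by (rule coprime_if[of 1 _ "-1"]) simp
    moreover have "coprime K E"
    proof -
      have "E = V + K * (V * (2 * K - 5) + 4)" by (simp add: E_def algebra_simps power2_eq_square)
      moreover have "coprime K V" using cop by (simp add: K_def V_def coprime_commute)
      ultimately show ?thesis
        by (metis coprime_iff_gcd_eq_1 gcd_add_mult add.commute mult.commute)
    qed
    ultimately show ?thesis by (simp add: coprime_dvd_mult_right_iff)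
  qed
  moreover have "2 * K - 1 dvd X"
  proof -
    have "2 * K - 1 dvd (K - 1) * (E * X)" using key by (metis dvd_triv_left mult.assoc)
    moreover have "coprime (2 * K - 1) (K - 1)" by (rule coprime_if[of 1 _ "-2"]) simp
    ultimately have "2 * K - 1 dvd E * X" by (simp add: coprime_dvd_mult_right_iff)
    then obtain s where s: "E * X = (2 * K - 1) * s" by blast
    \<comment> \<open>Division of \<open>E\<close> by \<open>2 k - 1\<close>, with remainder \<open>2 - v\<close>.\<close>
    have E: "E = (2 * K - 1) * (V * (K - 2) + 2) - (V - 2)"
      by (simp add: E_def algebra_simps power2_eq_square)
    have "X = (2 * K - 1) * (int ((v - 1) choose (2 * k - 1)) - (V * (K - 2) + 2) * X + s)"
      using s X unfolding E by (simp add: algebra_simps)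
    then show ?thesis by (metis dvd_triv_left)
  qed
  moreover have "coprime K (2 * K - 1)" by (rule coprime_if[of 2 _ "-1"]) simp
  ultimately have "K * (2 * K - 1) dvd X" by (simp add: divides_mult)
  then have "int (k * (2 * k - 1)) dvd int ((v - 2) choose (2 * k - 2))"
    by (simp only: of_nat_mult casts) (simp add: X_def K_def)
  then show ?thesis by (simp only: int_dvd_int_iff)
qed

text \<open>
  The meaning of the quotient \<open>r\<close>: as orbits have length \<open>v\<close>, there are \<open>r\<close> orbits of \<open>2 k\<close>-subsets for
  each of the \<open>(v - 1)/2\<close> orbits of pairs.
\<close>

lemma choose_double_eq:
  fixes v k :: nat
  assumes k: "v > 2 * k" "k \<ge> 3" "odd v" and r: "(v - 2) choose (2 * k - 2) = k * (2 * k - 1) * r"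
  shows "v choose (2 * k) = v * ((v - 1) div 2 * r)"
proof -
  have e1: "2 * k * (v choose (2 * k)) = v * ((v - 1) choose (2 * k - 1))"
    using times_binomial_minus1_eq[of "2 * k" v] k by simp
  have e2: "(2 * k - 1) * ((v - 1) choose (2 * k - 1)) = (v - 1) * ((v - 2) choose (2 * k - 2))"
    using times_binomial_minus1_eq[of "2 * k - 1" "v - 1"] k by (simp add: numeral_2_eq_2)
  have M: "v - 1 = 2 * ((v - 1) div 2)" using k by simp
  have "(2 * k - 1) * (2 * k) * (v choose (2 * k)) = v * ((2 * k - 1) * ((v - 1) choose (2 * k - 1)))"
    using e1 by (metis mult.assoc mult.left_commute)
  also have "\<dots> = v * (2 * ((v - 1) div 2) * (k * (2 * k - 1) * r))"
    using e2 r M by simp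
  also have "\<dots> = (2 * k - 1) * (2 * k) * (v * ((v - 1) div 2 * r))"
    by (simp only: mult.assoc mult.left_commute mult.commute)
  finally show ?thesis using k by simp
qed

lemma choose_cyclic_dvd:
  assumes "v > 0" "coprime v (Suc k)"
  obtains n where "v choose Suc k = v * n" "Suc k * n = (v - 1) choose k"
proof -
  have e: "Suc k * (v choose Suc k) = v * ((v - 1) choose k)"
    using binomial_absorption[of k v] by simp
  then have "v dvd Suc k * (v choose Suc k)" by simp
  then have "v dvd v choose Suc k" using assms(2) coprime_dvd_mult_right_iff by blast
  then obtain n where n: "v choose Suc k = v * n" by blast
  then have "v * (Suc k * n) = v * ((v - 1) choose k)" using e by (simp only: mult.left_commute)
  then have "Suc k * n = (v - 1) choose k" using assms(1) by simp
  then show thesis using that n by blast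
qed

text \<open>
  The left-hand side counts the blocks on three points of one copy, the right-hand side those on two
  points of one copy and one of the other.  The terms on the right come from the sizes \<open>(2 k, 2)\<close>,
  \<open>(2, 2 k)\<close> and \<open>(k + 1, k + 1)\<close>; the size \<open>(2, 2 k)\<close> contributes nothing on the left.  Multiplied by
  \<open>(k - 1) (2 k - 1)\<close>, the equation is a linear consequence of the balance equation and the absorption
  identities.
\<close>

lemma index_balance:
  fixes v k r z1 z2 :: nat and q :: int
  assumes k: "v > 2 * k" "k \<ge> 3"
    and r: "(v - 2) choose (2 * k - 2) = k * (2 * k - 1) * r"
    and bal: "int ((v - 3) choose (2 * k - 3)) * (int v * (2 * int k ^ 2 - 5 * int k + 1) + 4 * int k)
       = 2 * int ((v - 3) choose (k - 2)) * (int v - int k - 1) * (2 * int k - 1) * q"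
    and z2: "int z2 = int z1 * q"
  shows "((v - 3) choose (2 * k - 3)) * (z1 * v) + ((v - 3) choose (k - 2)) * (z2 * v)
    = ((v - 2) choose (2 * k - 2)) * (z1 * 2) + z1 * r * (2 * k) + ((v - 2) choose (k - 1)) * (z2 * (k + 1))"
proof -
  define V K where "V = int v" and "K = int k"
  define Y D where "Y = int ((v - 3) choose (2 * k - 3))" and "D = int ((v - 3) choose (k - 2))"
  define X W where "X = int ((v - 2) choose (2 * k - 2))" and "W = int ((v - 2) choose (k - 1))"
  have casts: "int (2 * k - 2) = 2 * K - 2" "int (2 * k - 1) = 2 * K - 1" "int (k - 1) = K - 1"
    "int (v - 2) = V - 2"
    using k by (auto simp: V_def K_def of_nat_diff)
  have XY: "(2 * K - 2) * X = (V - 2) * Y"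
    using int_times_binomial[of "2 * k - 2" "v - 2"] k casts by (simp add: X_def Y_def)
  have WD: "(K - 1) * W = (V - 2) * D"
    using int_times_binomial[of "k - 1" "v - 2"] k casts by (simp add: W_def D_def numeral_2_eq_2 numeral_3_eq_3)
  have Xr: "X = K * (2 * K - 1) * int r"
    unfolding X_def r by (simp only: of_nat_mult casts) (simp add: K_def)
  have "Y * (V * (2 * K ^ 2 - 5 * K + 1) + 4 * K) = 2 * D * (V - K - 1) * (2 * K - 1) * q"
    using bal by (simp add: V_def K_def Y_def D_def)
  then have "(K - 1) * (2 * K - 1) * (Y * V + D * (q * V))
      = (K - 1) * (2 * K - 1) * (X * 2 + int r * (2 * K) + W * (q * (K + 1)))"
    using XY WD Xr by algebra
  moreover have "(K - 1) * (2 * K - 1) \<noteq> 0" using k by (auto simp: K_def)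
  ultimately have "Y * V + D * (q * V) = X * 2 + int r * (2 * K) + W * (q * (K + 1))"
    by (simp only: mult_cancel_left) simp
  then have "Y * (int z1 * V) + D * (int z2 * V)
      = X * (int z1 * 2) + int z1 * int r * (2 * K) + W * (int z2 * (K + 1))"
    unfolding z2 by algebra
  then have "int (((v - 3) choose (2 * k - 3)) * (z1 * v) + ((v - 3) choose (k - 2)) * (z2 * v))
    = int (((v - 2) choose (2 * k - 2)) * (z1 * 2) + z1 * r * (2 * k) + ((v - 2) choose (k - 1)) * (z2 * (k + 1)))"
    unfolding V_def K_def Y_def D_def X_def W_def by (simp only: of_nat_add of_nat_mult) simp
  then show ?thesis by (simp only: of_nat_eq_iff)
qed

section \<open>The design\<close>

theorem theorem3p7:
  fixes v k z1 :: nat and A B z2 :: real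
  assumes "v > 2 * k" and "k \<ge> 3"
    and "gcd v (2 * k) = 1" and "gcd v (k + 1) = 1"
    and "A = real ((v - 3) choose (2 * k - 3))
              * ((real v * (4 * real k ^ 2 - 10 * real k + 2) + 8 * real k)
                 / ((2 * real k - 2) * (2 * real k - 1)))"
    and "B = 2 * real ((v - 3) choose (k - 2)) * ((real v - real k - 1) / (real k - 1))"
    and "A / B \<in> \<int>"
    and "1 \<le> z1" and "real z1 \<le> (real v - 1) / 2"
    and "z2 = real z1 * (A / B)"
    and "z2 \<le> 1 / (real k + 1) * real ((v - 1) choose k)"
  shows "\<exists>(\<Theta> :: nat) (X :: nat set) \<B>.
           real \<Theta> = real ((v - 2) choose (2 * k - 2)) * (4 * real k / (2 * real k - 1)) * real z1
                     + real ((v - 2) choose (k - 1)) * (real k + 1) * z2 \<and>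
           simple_design 3 (2 * v) (2 * (k + 1)) \<Theta> X \<B>"
proof -
  have "coprime v (2 * k)" "coprime v (k + 1)"
    using assms(3,4) by (simp_all only: coprime_iff_gcd_eq_1)
  then have cop: "coprime v (2 * k)" "coprime v (Suc k)" "coprime v k" and cop2: "coprime v 2"
    by simp_all
  have odd: "odd v" using cop2 by simp
  obtain q where q: "A / B = of_int q" using assms(7) by (auto elim: Ints_cases)
  have bal: "int ((v - 3) choose (2 * k - 3)) * (int v * (2 * int k ^ 2 - 5 * int k + 1) + 4 * int k)
       = 2 * int ((v - 3) choose (k - 2)) * (int v - int k - 1) * (2 * int k - 1) * q"
    using assms(1,2,5,6) q by (rule balance_equation_integral)
  obtain r where r: "(v - 2) choose (2 * k - 2) = k * (2 * k - 1) * r"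
    using equal_classes_dvd[OF assms(1,2) cop(3) bal] by blast
  define M where "M = (v - 1) div 2"
  have pairs: "v choose 2 = v * (M * 1)"
    using odd by (simp add: M_def choose_two div_mult_swap)
  have doubles: "v choose (2 * k) = v * (M * r)"
    using choose_double_eq[OF assms(1,2) odd r] by (simp add: M_def)
  obtain K where K: "v choose Suc k = v * K" "Suc k * K = (v - 1) choose k"
    using choose_cyclic_dvd[of v k] assms(1) cop(2) by auto
  have "A / B \<ge> 0"
  proof -
    have "real k ^ 2 \<ge> 3 * real k" using assms(2) by (simp add: power2_eq_square)
    then have "4 * real k ^ 2 - 10 * real k + 2 \<ge> 0" by linarith
    then have "A \<ge> 0" unfolding assms(5) using assms(2) by simp
    moreover have "B \<ge> 0" unfolding assms(6) using assms(1,2) by simp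
    ultimately show ?thesis by simp
  qed
  then have "q \<ge> 0" using q by simp
  define m where "m = z1 * nat q"
  have m: "int m = int z1 * q" using \<open>q \<ge> 0\<close> by (simp add: m_def)
  have z2: "z2 = real m" using \<open>q \<ge> 0\<close> by (simp add: m_def assms(10) q)
  have "m \<le> K"
  proof -
    have "real (Suc k) * real K = real ((v - 1) choose k)" using K(2) by (metis of_nat_mult)
    then have "1 / (real k + 1) * real ((v - 1) choose k) = real K" by (simp add: field_simps)
    then show ?thesis using assms(11) by (simp add: z2)
  qed
  have "z1 \<le> M"
  proof -
    have "2 * M + 1 = v" using odd by (simp add: M_def)
    then have "real v = 2 * real M + 1" by (metis of_nat_1 of_nat_add of_nat_mult of_nat_numeral)
    then show ?thesis using assms(9) by simp
  qed
  have "v > 0" using assms(1) by simp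
  obtain e where e: "balanced_colouring v 2 M 1 e"
    using ex_balanced_colouring[OF \<open>v > 0\<close> cop2 pairs] by blast
  obtain d where d: "balanced_colouring v (2 * k) M r d"
    using ex_balanced_colouring[OF \<open>v > 0\<close> cop(1) doubles] by blast
  obtain h where h: "balanced_colouring v (Suc k) K 1 h"
    using ex_balanced_colouring[OF \<open>v > 0\<close> cop(2), of K 1] K(1) by auto
  \<comment> \<open>Pairs have one orbit per colour and \<open>2 k\<close>-subsets have \<open>r\<close>, so that both use the same \<open>M\<close> colours
     and can be coupled; the \<open>(k + 1)\<close>-subsets are coupled among themselves.\<close>
  define C1 where "C1 = coupled_pairs v (2 * k) d 2 e M z1"
  define C2 where "C2 = coupled_pairs v 2 e (2 * k) d M z1"
  define C3 where "C3 = coupled_pairs v (Suc k) h (Suc k) h K m"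
  define C where "C = C1 \<union> C2 \<union> C3"
  define L where "L = ((v - 3) choose (2 * k - 3)) * (z1 * v) + ((v - 3) choose (k - 2)) * (m * v)"
  have L: "L = ((v - 2) choose (2 * k - 2)) * (z1 * 2) + z1 * r * (2 * k)
             + ((v - 2) choose (k - 1)) * (m * (k + 1))"
    unfolding L_def using assms(1,2) r bal m by (rule index_balance)
  have in1: "S \<in> ksubsets v (2 * k) \<and> T \<in> ksubsets v 2" if "(S, T) \<in> C1" for S T
    using that by (simp add: C1_def coupled_pairs_def)
  have in2: "S \<in> ksubsets v 2 \<and> T \<in> ksubsets v (2 * k)" if "(S, T) \<in> C2" for S T
    using that by (simp add: C2_def coupled_pairs_def)
  have in3: "S \<in> ksubsets v (Suc k) \<and> T \<in> ksubsets v (Suc k)" if "(S, T) \<in> C3" for S T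
    using that by (simp add: C3_def coupled_pairs_def)
  have fin: "finite C1" "finite C2" "finite C3"
    by (simp_all add: C1_def C2_def C3_def finite_coupled_pairs)
  \<comment> \<open>The three kinds of blocks are told apart by their sizes in the first copy, \<open>2 < k + 1 < 2 k\<close>.\<close>
  have disj: "C1 \<inter> C2 = {}" "C1 \<inter> C3 = {}" "C2 \<inter> C3 = {}"
    using in1 in2 in3 assms(2) by (fastforce simp: ksubsets_def)+
  have split: "card {(S, T) \<in> C. P \<subseteq> S \<and> Q \<subseteq> T} =
      card {(S, T) \<in> C1. P \<subseteq> S \<and> Q \<subseteq> T} + card {(S, T) \<in> C2. P \<subseteq> S \<and> Q \<subseteq> T}
        + card {(S, T) \<in> C3. P \<subseteq> S \<and> Q \<subseteq> T}" for P Q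
  proof -
    let ?g = "\<lambda>D. {(S, T) \<in> D. P \<subseteq> S \<and> Q \<subseteq> T}"
    have sub: "?g D \<subseteq> D" for D by auto
    have finite': "finite (?g C1)" "finite (?g C2)" "finite (?g C3)"
      by (rule finite_subset[OF sub fin(1)], rule finite_subset[OF sub fin(2)],
          rule finite_subset[OF sub fin(3)])
    have "?g C = (?g C1 \<union> ?g C2) \<union> ?g C3" unfolding C_def by auto
    moreover have "(?g C1 \<union> ?g C2) \<inter> ?g C3 = {}" "?g C1 \<inter> ?g C2 = {}" using disj by auto
    ultimately show ?thesis using finite' by (simp add: card_Un_disjoint)
  qed
  have "simple_design 3 (2 * v) (2 * (k + 1)) L {0..<2 * v} (mset_set (join_copies v ` C))"
  proof (rule simple_design_of_symmetric_pairs)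
    fix S T assume "(S, T) \<in> C"
    then show "S \<subseteq> {0..<int v} \<and> T \<subseteq> {0..<int v} \<and> card S + card T = 2 * (k + 1)"
      using in1[of S T] in2[of S T] in3[of S T] by (auto simp: C_def ksubsets_def)
  next
    show "prod.swap ` C = C"
      by (simp add: C_def C1_def C2_def C3_def image_Un swap_coupled_pairs Un_commute)
  next
    fix P :: "int set" assume P: "P \<subseteq> {0..<int v}" "card P = 3"
    have "card {(S, T) \<in> C. P \<subseteq> S} = card {(S, T) \<in> C. P \<subseteq> S \<and> {} \<subseteq> T}" by simp
    also have "\<dots> = L"
      unfolding split C1_def C2_def C3_def L_def
      using card_coupled_pairs_containing[OF e \<open>z1 \<le> M\<close>, of "{}"]
        card_coupled_pairs_containing[OF d \<open>z1 \<le> M\<close>, of "{}"]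
        card_coupled_pairs_containing[OF h \<open>m \<le> K\<close>, of "{}"]
        card_ksubsets_containing[OF P] assms(2)
      by (simp add: numeral_3_eq_3 numeral_2_eq_2)
    finally show "card {(S, T) \<in> C. P \<subseteq> S} = L" .
  next
    fix P :: "int set" and x assume P: "P \<subseteq> {0..<int v}" "card P = 2" and x: "x \<in> {0..<int v}"
    have x': "{x} \<subseteq> {0..<int v}" "card {x} \<le> 1" using x by auto
    show "card {(S, T) \<in> C. P \<subseteq> S \<and> {x} \<subseteq> T} = L"
      unfolding split C1_def C2_def C3_def L
        card_coupled_pairs_containing[OF e \<open>z1 \<le> M\<close> x']
        card_coupled_pairs_containing[OF d \<open>z1 \<le> M\<close> x']
        card_coupled_pairs_containing[OF h \<open>m \<le> K\<close> x']
        card_ksubsets_containing[OF P]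
      using assms(2) by (simp add: numeral_2_eq_2)
  qed
  moreover have "real L = real ((v - 2) choose (2 * k - 2)) * (4 * real k / (2 * real k - 1)) * real z1
      + real ((v - 2) choose (k - 1)) * (real k + 1) * z2"
  proof -
    have casts: "real (2 * k - 1) = 2 * real k - 1" using assms(2) by (simp add: of_nat_diff)
    have X: "real ((v - 2) choose (2 * k - 2)) = real k * (2 * real k - 1) * real r"
      unfolding r by (simp only: of_nat_mult casts)
    have "2 * real k - 1 \<noteq> 0" using assms(2) by simp
    then have "real k * (2 * real k - 1) * real r * (4 * real k / (2 * real k - 1))
        = real k * (2 * real k - 1) * real r * 2 + real r * (2 * real k)"
      by (simp add: field_simps)
    then show ?thesis
      unfolding L of_nat_add of_nat_mult z2 X by (simp add: algebra_simps)
  qed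
  ultimately show ?thesis by blast
qed

end
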